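(* Let $G$ be the disjoint union or the join of two graphs $G_1$ and $G_2$. Then at least one of the following holds: (i) $G$ is recolorable; (ii) $G_i$ is not recolorable for some $i\in\{1,2\}$. Furthermore, if $G_1$ and $G_2$ are good then $G$ is good.
   Context: All graphs are finite and simple. The join of two vertex-disjoint graphs $G_1$, $G_2$ is obtained from their disjoint union by joining each vertex of $G_1$ to every vertex of $G_2$. A $k$-coloring of $G$ is a map $V(G)\to\{1,\dots,k\}$ giving adjacent vertices different values; $\chi(G)$ is the chromatic number, and a $\chi$-coloring of $G$ is a $\chi(G)$-coloring. $R_k(G)$ denotes the graph whose vertices are the $k$-colorings of $G$, two being adjacent if they differ in color on exactly one vertex. $G$ is recolorable if $R_\ell(G)$ is connected for all $\ell\ge\chi(G)+1$. A graph $G$ on $n$ vertices is good if there exists a $\chi$-coloring of $G$ which, for all $\ell\ge\chi(G)+1$, can be reached from any coloring in $R_\ell(G)$ by a path in $R_\ell(G)$ along which each vertex is recolored at most $n$ times (with $n$ being the number of vertices of the graph in question). *)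

theory Defs
  imports "Graph_Theory.Graph_Theory" "HOL-Library.FuncSet"
begin

text \<open>
  A finite simple graph is a \<^locale>\<open>pair_graph\<close>: a finite, loop-free, symmetric
  digraph whose arcs are pairs of vertices, so that an edge \<open>uv\<close> is the pair of arcs
  \<open>(u, v)\<close>, \<open>(v, u)\<close>. The graph without vertices is included.
\<close>

text \<open>The two operations below are meant for graphs with disjoint vertex sets.\<close>

definition disjoint_union ::
    "'a pair_pre_digraph \<Rightarrow> 'a pair_pre_digraph \<Rightarrow> 'a pair_pre_digraph" where
  "disjoint_union G H = \<lparr> pverts = pverts G \<union> pverts H, parcs = parcs G \<union> parcs H \<rparr>"

definition join ::
    "'a pair_pre_digraph \<Rightarrow> 'a pair_pre_digraph \<Rightarrow> 'a pair_pre_digraph" where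
  "join G H = \<lparr> pverts = pverts (disjoint_union G H),
    parcs = parcs (disjoint_union G H) \<union> pverts G \<times> pverts H \<union> pverts H \<times> pverts G \<rparr>"

text \<open>
  Colorings are extensional (\<open>undefined\<close> off the vertex set), so that they are determined
  by their values on the vertices.
\<close>

definition colorings :: "'a pair_pre_digraph \<Rightarrow> nat \<Rightarrow> ('a \<Rightarrow> nat) set" where
  "colorings G k = {c \<in> pverts G \<rightarrow>\<^sub>E {1..k}. \<forall>(u, v) \<in> parcs G. c u \<noteq> c v}"

definition chromatic_number :: "'a pair_pre_digraph \<Rightarrow> nat" where
  "chromatic_number G = (LEAST k. colorings G k \<noteq> {})"

definition reconf_graph :: "'a pair_pre_digraph \<Rightarrow> nat \<Rightarrow> ('a \<Rightarrow> nat) pair_pre_digraph" where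
  "reconf_graph G k = \<lparr> pverts = colorings G k,
    parcs = {(c, d). c \<in> colorings G k \<and> d \<in> colorings G k \<and> (\<exists>!v. v \<in> pverts G \<and> c v \<noteq> d v)} \<rparr>"

definition recolorable :: "'a pair_pre_digraph \<Rightarrow> bool" where
  "recolorable G \<longleftrightarrow> (\<forall>l \<ge> chromatic_number G + 1. connected (with_proj (reconf_graph G l)))"

text \<open>
  A path is given by its list of arcs; an arc \<open>(c, d)\<close> of the reconfiguration graph
  recolors \<open>v\<close> if and only if \<open>c v \<noteq> d v\<close>.
\<close>

definition num_recolorings :: "(('a \<Rightarrow> nat) \<times> ('a \<Rightarrow> nat)) list \<Rightarrow> 'a \<Rightarrow> nat" where
  "num_recolorings p v = length (filter (\<lambda>(c, d). c v \<noteq> d v) p)"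

definition good :: "'a pair_pre_digraph \<Rightarrow> bool" where
  "good G \<longleftrightarrow>
    (\<exists>b \<in> colorings G (chromatic_number G).
      \<forall>l \<ge> chromatic_number G + 1. \<forall>a \<in> colorings G l.
        \<exists>p. pre_digraph.apath (with_proj (reconf_graph G l)) a p b \<and>
            (\<forall>v \<in> pverts G. num_recolorings p v \<le> card (pverts G)))"

lemma pair_graph_iff:
  "pair_graph G \<longleftrightarrow> finite (pverts G) \<and> parcs G \<subseteq> pverts G \<times> pverts G \<and> sym (parcs G)
     \<and> irrefl (parcs G)" (is "_ \<longleftrightarrow> ?R")
proof
  assume "pair_graph G"
  then interpret pair_graph G .
  show ?R
    using pair_finite_verts arc_fst_in_verts arc_snd_in_verts pair_no_loops pair_sym_arcs
    by (fastforce simp: symmetric_def irrefl_def)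
next
  assume R: ?R
  then have "finite (parcs G)"
    by (meson finite_SigmaI finite_subset)
  with R show "pair_graph G"
    by unfold_locales (auto simp: symmetric_def irrefl_def)
qed

lemma pair_graph_disjoint_union:
  assumes "pair_graph G" "pair_graph H"
  shows "pair_graph (disjoint_union G H)"
  using assms by (auto simp: pair_graph_iff disjoint_union_def irrefl_def intro: sym_Un)

lemma pair_graph_join:
  assumes "pair_graph G" "pair_graph H" "pverts G \<inter> pverts H = {}"
  shows "pair_graph (join G H)"
  using assms by (auto simp: pair_graph_iff join_def disjoint_union_def irrefl_def sym_def)

lemma pair_graph_reconf_graph:
  assumes "pair_graph G"
  shows "pair_graph (reconf_graph G k)"
proof -
  have "finite (pverts G \<rightarrow>\<^sub>E {1..k})"
    using assms by (auto simp: pair_graph_iff intro: finite_PiE)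
  then have "finite (colorings G k)"
    by (rule rev_finite_subset) (auto simp: colorings_def)
  then show ?thesis
    by (auto simp: pair_graph_iff reconf_graph_def irrefl_def intro!: symI)
qed

text \<open>Every finite simple graph has a coloring, so the minimum above exists.\<close>

lemma colorings_chromatic_number_nonempty:
  assumes "pair_graph G"
  shows "colorings G (chromatic_number G) \<noteq> {}"
proof -
  have "finite (pverts G)"
    using assms by (simp add: pair_graph_iff)
  then obtain f where f: "bij_betw f (pverts G) {1..card (pverts G)}"
    using finite_same_card_bij[of "pverts G" "{1..card (pverts G)}"] by auto
  have "f u \<noteq> f v" "u \<in> pverts G" "v \<in> pverts G" if "(u, v) \<in> parcs G" for u v
  proof -
    show "u \<in> pverts G" "v \<in> pverts G"
      using assms that by (auto simp: pair_graph_iff)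
    moreover have "u \<noteq> v"
      using assms that by (auto simp: pair_graph_iff irrefl_def)
    ultimately show "f u \<noteq> f v"
      using f by (auto simp: bij_betw_def inj_on_def)
  qed
  then have "restrict f (pverts G) \<in> colorings G (card (pverts G))"
    using f by (auto simp: colorings_def bij_betw_def)
  then show ?thesis
    unfolding chromatic_number_def
    by (intro LeastI[where P = "\<lambda>k. colorings G k \<noteq> {}"]) blast
qed

end

theory Submission
  imports Defs "HOL-Library.Extended_Nat"
begin

text \<open>
  For the disjoint union, the two graphs are recolored one after the other. For the join with
  \<open>l \<ge> \<chi>(G1) + \<chi>(G2) + 1\<close> colors, one of the two graphs, say \<open>G1\<close>, has at least \<open>\<chi>(G1) + 1\<close> colors that
  the other one does not use, so within these colors it can be brought to a copy of its
  target \<open>\<chi>(G1)\<close>-coloring. Then \<open>\<chi>(G2) + 1\<close> colors are left for \<open>G2\<close>, which is treated alike. Now \<open>G\<close> has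
  the target coloring up to a renaming of colors and at least one color is unused; whole
  color classes are moved to free colors, each at most twice, until the target is reached. This
  costs every vertex two additional recolorings, which is within the budget if both graphs
  have at least two vertices; the join with a single vertex needs a more careful choice of copies.
\<close>

section \<open>Colorings with an arbitrary palette\<close>

text \<open>In a join each side may use only the colors that the other side leaves free. These need
  not form an initial segment, so palettes are arbitrary sets.\<close>

definition proper_colorings :: "'a pair_pre_digraph \<Rightarrow> nat set \<Rightarrow> ('a \<Rightarrow> nat) set" where
  "proper_colorings G S = {c \<in> pverts G \<rightarrow>\<^sub>E S. \<forall>(u, v) \<in> parcs G. c u \<noteq> c v}"

lemma colorings_eq: "colorings G k = proper_colorings G {1..k}"
  by (simp add: colorings_def proper_colorings_def)

lemma proper_colorings_mono: "S \<subseteq> T \<Longrightarrow> proper_colorings G S \<subseteq> proper_colorings G T"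
  by (auto simp: proper_colorings_def PiE_iff)

lemma proper_colorings_compose:
  assumes "parcs G \<subseteq> pverts G \<times> pverts G" "c \<in> proper_colorings G S"
    and "inj_on \<pi> S" "\<pi> ` S \<subseteq> T"
  shows "compose (pverts G) \<pi> c \<in> proper_colorings G T"
proof -
  have c: "c u \<in> S" if "u \<in> pverts G" for u
    using assms(2) that by (auto simp: proper_colorings_def)
  have "compose (pverts G) \<pi> c u \<noteq> compose (pverts G) \<pi> c v" if "(u, v) \<in> parcs G" for u v
  proof -
    have "u \<in> pverts G" "v \<in> pverts G" "c u \<noteq> c v"
      using that assms(1,2) by (auto simp: proper_colorings_def)
    then show ?thesis
      using c inj_onD[OF assms(3)] by (auto simp: compose_eq)
  qed
  moreover have "compose (pverts G) \<pi> c \<in> pverts G \<rightarrow>\<^sub>E T"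
    using c assms(4) by (auto simp: compose_def)
  ultimately show ?thesis
    by (auto simp: proper_colorings_def)
qed

lemma compose_cong_PiE:
  assumes "c \<in> A \<rightarrow>\<^sub>E S" "\<And>s. s \<in> S \<Longrightarrow> f s = g s"
  shows "compose A f c = compose A g c"
  unfolding compose_def by (rule restrict_ext) (use assms in auto)

lemma compose_id_PiE:
  assumes "c \<in> A \<rightarrow>\<^sub>E S" "\<And>s. s \<in> S \<Longrightarrow> f s = s"
  shows "compose A f c = c"
proof (rule extensionalityI)
  show "c \<in> extensional A"
    using assms(1) by (simp add: PiE_iff)
  show "compose A f c x = c x" if "x \<in> A" for x
    using assms that by (auto simp: compose_eq)
qed (simp add: compose_extensional)

lemma proper_colorings_image:
  "c \<in> proper_colorings G S \<Longrightarrow> c \<in> proper_colorings G (c ` pverts G)"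
  by (auto simp: proper_colorings_def PiE_iff)

text \<open>Renumbering the palette as an initial segment makes the minimality of
  \<open>chromatic_number\<close> applicable.\<close>

lemma chromatic_number_le_card:
  assumes "parcs G \<subseteq> pverts G \<times> pverts G" "c \<in> proper_colorings G S" "finite S"
  shows "chromatic_number G \<le> card S"
proof -
  obtain f where "bij_betw f S {1..card S}"
    using \<open>finite S\<close> finite_same_card_bij[of S "{1..card S}"] by auto
  then have "compose (pverts G) f c \<in> colorings G (card S)"
    unfolding colorings_eq
    by (intro proper_colorings_compose[OF assms(1,2)]) (auto simp: bij_betw_def)
  then show ?thesis
    unfolding chromatic_number_def by (intro Least_le) blast
qed

section \<open>Sequences of recolorings\<close>

text \<open>
  \<open>m v\<close> bounds the number of recolorings of \<open>v\<close>; the infinite budget expresses mere reachability,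
  so that recolorability and goodness are treated at once.
\<close>

inductive recolors ::
    "'a pair_pre_digraph \<Rightarrow> nat set \<Rightarrow> ('a \<Rightarrow> enat) \<Rightarrow> ('a \<Rightarrow> nat) \<Rightarrow> ('a \<Rightarrow> nat) \<Rightarrow> bool"
  for G S where
    refl: "c \<in> proper_colorings G S \<Longrightarrow> recolors G S m c c"
  | step: "recolors G S m c d \<Longrightarrow> d(v := x) \<in> proper_colorings G S \<Longrightarrow> v \<in> pverts G \<Longrightarrow>
      (\<And>u. u \<in> pverts G \<Longrightarrow> m u + of_bool (u = v) \<le> m' u) \<Longrightarrow> recolors G S m' c (d(v := x))"

lemma recolors_proper:
  assumes "recolors G S m c d"
  shows "c \<in> proper_colorings G S" "d \<in> proper_colorings G S"
  using assms by (induction) auto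

text \<open>The slack in the last premise of \<open>recolors.step\<close> absorbs the larger budget,
  so a case split on the last step suffices.\<close>

lemma recolors_weaken:
  assumes "recolors G S m c d" "\<And>u. u \<in> pverts G \<Longrightarrow> m u \<le> m' u"
  shows "recolors G S m' c d"
  using assms(1)
proof (cases rule: recolors.cases)
  case refl
  then show ?thesis by (simp add: recolors.refl)
next
  case (step m0 d0 v x)
  show ?thesis
    unfolding step(1) using step(2-4)
  proof (rule recolors.step)
    show "m0 u + of_bool (u = v) \<le> m' u" if "u \<in> pverts G" for u
      using step(5)[OF that] assms(2)[OF that] by (rule order_trans)
  qed
qed

text \<open>The induction runs over the later segment, which is why it is listed first: its steps
  are appended one by one to the earlier segment.\<close>

lemma recolors_trans:
  assumes "recolors G S m' d e" "recolors G S m c d"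
  shows "recolors G S (\<lambda>u. m u + m' u) c e"
  using assms
proof (induction rule: recolors.induct)
  case (refl c m')
  show ?case
    by (rule recolors_weaken[OF refl(2)]) simp
next
  case (step m' d' d v x m'')
  have "m u + m' u + of_bool (u = v) \<le> m u + m'' u" if "u \<in> pverts G" for u
    using step.hyps(4)[OF that] by (simp only: add.assoc add_left_mono)
  with step.IH[OF step.prems] step.hyps(2,3) show ?case
    by (rule recolors.step)
qed

lemma recolors_single:
  assumes "c \<in> proper_colorings G S" "c(v := x) \<in> proper_colorings G S" "v \<in> pverts G"
  shows "recolors G S (\<lambda>u. of_bool (u = v)) c (c(v := x))"
  by (rule recolors.step[OF recolors.refl[OF assms(1), where m = "\<lambda>_. 0"] assms(2,3)]) simp

text \<open>Giving the last recolored vertex its old color back undoes the step at the same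
  cost.\<close>

lemma recolors_sym:
  assumes "recolors G S m c d"
  shows "recolors G S m d c"
  using assms
proof (induction)
  case (refl c m)
  then show ?case by (rule recolors.refl)
next
  case (step m c d v x m')
  have "recolors G S (\<lambda>u. of_bool (u = v)) (d(v := x)) ((d(v := x))(v := d v))"
    using step.hyps recolors_proper(2)[OF step.hyps(1)] by (intro recolors_single) simp_all
  then have "recolors G S (\<lambda>u. of_bool (u = v) + m u) (d(v := x)) c"
    using recolors_trans[OF step.IH] by simp
  then show ?case
  proof (rule recolors_weaken)
    show "of_bool (u = v) + m u \<le> m' u" if "u \<in> pverts G" for u
      using step.hyps(4)[OF that] by (simp only: add.commute)
  qed
qed

text \<open>Renaming colors commutes with updating a single vertex, so steps are mapped to steps at
  the same vertices.\<close>

lemma recolors_compose: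
  assumes "parcs G \<subseteq> pverts G \<times> pverts G" "recolors G S m c d"
    and "inj_on \<pi> S" "\<pi> ` S \<subseteq> T"
  shows "recolors G T m (compose (pverts G) \<pi> c) (compose (pverts G) \<pi> d)"
  using assms(2)
proof (induction)
  case (refl c m)
  then show ?case by (rule recolors.refl[OF proper_colorings_compose[OF assms(1) _ assms(3,4)]])
next
  case (step m c d v x m')
  have eq: "compose (pverts G) \<pi> (d(v := x)) = (compose (pverts G) \<pi> d)(v := \<pi> x)"
    using step.hyps by (auto simp: compose_def)
  have "compose (pverts G) \<pi> (d(v := x)) \<in> proper_colorings G T"
    using step.hyps(2) by (rule proper_colorings_compose[OF assms(1) _ assms(3,4)])
  with step.IH step.hyps(3,4) show ?case
    unfolding eq by (intro recolors.step)
qed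

section \<open>Recoloring sequences and walks in the reconfiguration graph\<close>

lemma num_recolorings_append [simp]:
  "num_recolorings (p @ q) v = num_recolorings p v + num_recolorings q v"
  by (simp add: num_recolorings_def)

lemma num_recolorings_Cons [simp]:
  "num_recolorings (e # p) v = of_bool (fst e v \<noteq> snd e v) + num_recolorings p v"
  by (auto simp: num_recolorings_def split: prod.splits)

lemma num_recolorings_Nil [simp]: "num_recolorings [] v = 0"
  by (simp add: num_recolorings_def)

text \<open>Brings arcs into the shape of \<open>recolors.step\<close>. Both colorings are
  \<open>undefined\<close> off the vertex set, so agreement on all vertices but one makes them
  differ by a single function update.\<close>

lemma parcs_reconf_graph_iff:
  "(c, d) \<in> parcs (reconf_graph G k) \<longleftrightarrow> c \<in> colorings G k \<and> d \<in> colorings G k \<and>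
     (\<exists>v \<in> pverts G. c v \<noteq> d v \<and> d = c(v := d v))"
proof -
  have "d = c(v := d v)"
    if "c \<in> colorings G k" "d \<in> colorings G k" "\<And>w. w \<in> pverts G \<Longrightarrow> c w \<noteq> d w \<Longrightarrow> w = v" for v
  proof
    fix w
    have "c w = undefined \<and> d w = undefined" if "w \<notin> pverts G"
      using that \<open>c \<in> colorings G k\<close> \<open>d \<in> colorings G k\<close>
      by (simp add: colorings_def PiE_iff extensional_def)
    then have "w = v \<or> c w = d w"
      using that(3)[of w] by metis
    then show "d w = (c(v := d v)) w"
      by auto
  qed
  moreover have "w = v" if "d = c(v := d v)" "c w \<noteq> d w" for v w
    using that by (metis fun_upd_other)
  ultimately have "(\<exists>!v. v \<in> pverts G \<and> c v \<noteq> d v) \<longleftrightarrow> (\<exists>v \<in> pverts G. c v \<noteq> d v \<and> d = c(v := d v))"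
    if "c \<in> colorings G k" "d \<in> colorings G k"
    unfolding Ex1_def Bex_def using that by (intro iffI) metis+
  then show ?thesis
    unfolding reconf_graph_def by auto
qed

text \<open>The sequence is first read as a walk; cutting out cycles then yields a path and never
  increases \<open>num_recolorings\<close>.\<close>

lemma recolors_imp_apath:
  assumes "pair_graph G" "recolors G {1..k} m a b"
  obtains p where "pre_digraph.apath (with_proj (reconf_graph G k)) a p b"
    "\<And>v. v \<in> pverts G \<Longrightarrow> enat (num_recolorings p v) \<le> m v"
proof -
  interpret R: pair_graph "reconf_graph G k"
    using assms(1) by (rule pair_graph_reconf_graph)
  have "\<exists>p. R.awalk a p b \<and> (\<forall>v \<in> pverts G. enat (num_recolorings p v) \<le> m v)"
    using assms(2)
  proof (induction)
    case (refl c m)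
    then have "R.awalk c [] c"
      by (simp add: R.awalk_Nil_iff) (simp add: reconf_graph_def colorings_eq)
    then show ?case by (intro exI[of _ "[]"]) (simp add: zero_enat_def[symmetric])
  next
    case (step m c d v x m')
    then obtain p where p: "R.awalk c p d"
        "\<And>v. v \<in> pverts G \<Longrightarrow> enat (num_recolorings p v) \<le> m v"
      by blast
    show ?case
    \<comment> \<open>A step of \<open>recolors\<close> may rewrite the color that the vertex
      already has. This is not an arc, so the walk stays as it is.\<close>
    proof (cases "d v = x")
      case True
      have "enat (num_recolorings p u) \<le> m' u" if "u \<in> pverts G" for u
      proof -
        have "enat (num_recolorings p u) \<le> m u"
          using p(2)[OF that] .
        also have "m u \<le> m u + of_bool (u = v)"
          by (rule add_increasing2) simp_all
        also have "\<dots> \<le> m' u"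
          using step.hyps(4)[OF that] .
        finally show ?thesis .
      qed
      then show ?thesis
        using p(1) True by (auto simp: fun_upd_idem)
    next
      case False
      have "(d, d(v := x)) \<in> parcs (reconf_graph G k)"
        unfolding parcs_reconf_graph_iff colorings_eq
        using recolors_proper(2)[OF step.hyps(1)] step.hyps(2,3) False by (simp add: bexI[of _ v])
      then have "R.awalk d [(d, d(v := x))] (d(v := x))"
        using R.in_arcsD2 by (simp add: R.awalk_Cons_iff R.awalk_Nil_iff)
      with p(1) have walk: "R.awalk c (p @ [(d, d(v := x))]) (d(v := x))"
        by (rule R.awalk_appendI)
      have "enat (num_recolorings (p @ [(d, d(v := x))]) u) \<le> m' u" if "u \<in> pverts G" for u
      proof -
        have "enat (num_recolorings (p @ [(d, d(v := x))]) u)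
            \<le> enat (num_recolorings p u) + of_bool (u = v)"
          by (auto simp: one_enat_def)
        also have "\<dots> \<le> m u + of_bool (u = v)"
          using p(2)[OF that] by (rule add_right_mono)
        also have "\<dots> \<le> m' u"
          using step.hyps(4)[OF that] .
        finally show ?thesis .
      qed
      with walk show ?thesis by blast
    qed
  qed
  then obtain p where p: "R.awalk a p b"
      "\<And>v. v \<in> pverts G \<Longrightarrow> enat (num_recolorings p v) \<le> m v"
    by blast
  have "\<exists>q. R.apath a q b \<and> (\<forall>v. num_recolorings q v \<le> num_recolorings p v)"
    using p(1)
  proof (induction rule: R.awalk_to_apath_induct)
    case (path p)
    then show ?case by (auto simp: R.apath_def)
  next
    case (decomp p q r s)
    have "p = q @ r @ s"
      using R.awalk_cyc_decompE[OF decomp(2,1)] decomp(3) by auto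
    moreover obtain t where "R.apath a t b" "\<And>v. num_recolorings t v \<le> num_recolorings (q @ s) v"
      using decomp.IH by blast
    moreover have "num_recolorings (q @ s) v \<le> num_recolorings (q @ r @ s) v" for v
      by simp
    ultimately show ?case
      by (blast intro: order_trans)
  qed
  then show ?thesis
    using that p(2) by (meson enat_ord_simps(1) order_trans)
qed

text \<open>The induction takes arcs off the end of the walk, where \<open>recolors.step\<close>
  adds its steps.\<close>

lemma awalk_imp_recolors:
  assumes "pair_graph G" "pre_digraph.awalk (with_proj (reconf_graph G k)) a p b"
  shows "recolors G {1..k} (\<lambda>v. enat (num_recolorings p v)) a b"
proof -
  interpret R: pair_graph "reconf_graph G k"
    using assms(1) by (rule pair_graph_reconf_graph)
  show ?thesis
    using assms(2)
  proof (induction p arbitrary: b rule: rev_induct)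
    case Nil
    then have "a = b" "b \<in> pverts (reconf_graph G k)"
      by (auto simp: R.awalk_Nil_iff)
    then show ?case
      by (simp add: reconf_graph_def colorings_eq recolors.refl)
  next
    case (snoc e p)
    obtain c where e: "e = (c, b)" and walk: "R.awalk a p c" and arc: "(c, b) \<in> parcs (reconf_graph G k)"
      using snoc.prems by (cases e) (auto simp: R.awalk_append_iff R.awalk_Cons_iff R.awalk_Nil_iff)
    obtain v where v: "v \<in> pverts G" "c v \<noteq> b v" "b = c(v := b v)" and b: "b \<in> proper_colorings G {1..k}"
      using arc unfolding parcs_reconf_graph_iff colorings_eq by blast
    have "recolors G {1..k} (\<lambda>v. enat (num_recolorings (p @ [e]) v)) a (c(v := b v))"
      using snoc.IH[OF walk]
    proof (rule recolors.step)
      show "c(v := b v) \<in> proper_colorings G {1..k}" "v \<in> pverts G"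
        using v b by auto
      show "enat (num_recolorings p u) + of_bool (u = v) \<le> enat (num_recolorings (p @ [e]) u)" for u
        using v(2) by (auto simp: e one_enat_def)
    qed
    then show ?case using v(3) by simp
  qed
qed

section \<open>A common form of goodness and recolorability\<close>

text \<open>\<open>N = card (pverts G)\<close> gives goodness and \<open>N = \<infinity>\<close>
  gives recolorability. As in \<open>good\<close>, the target is chosen before
  \<open>l\<close>.\<close>

definition reducible :: "'a pair_pre_digraph \<Rightarrow> enat \<Rightarrow> bool" where
  "reducible G N \<longleftrightarrow> (\<exists>b \<in> colorings G (chromatic_number G).
     \<forall>l \<ge> chromatic_number G + 1. \<forall>a \<in> colorings G l. recolors G {1..l} (\<lambda>_. N) a b)"

lemma good_iff_reducible:
  assumes "pair_graph G"
  shows "good G \<longleftrightarrow> reducible G (enat (card (pverts G)))"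
proof -
  have "(\<exists>p. pre_digraph.apath (with_proj (reconf_graph G l)) a p b \<and>
            (\<forall>v \<in> pverts G. num_recolorings p v \<le> card (pverts G)))
        \<longleftrightarrow> recolors G {1..l} (\<lambda>_. enat (card (pverts G))) a b" for l a b
  proof
    assume "recolors G {1..l} (\<lambda>_. enat (card (pverts G))) a b"
    from recolors_imp_apath[OF assms this] show "\<exists>p. pre_digraph.apath (with_proj (reconf_graph G l)) a p b \<and>
            (\<forall>v \<in> pverts G. num_recolorings p v \<le> card (pverts G))"
      by (metis enat_ord_simps(1))
  next
    assume "\<exists>p. pre_digraph.apath (with_proj (reconf_graph G l)) a p b \<and>
            (\<forall>v \<in> pverts G. num_recolorings p v \<le> card (pverts G))"
    then obtain p where "pre_digraph.awalk (with_proj (reconf_graph G l)) a p b"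
        and "\<And>v. v \<in> pverts G \<Longrightarrow> num_recolorings p v \<le> card (pverts G)"
      by (auto simp: pre_digraph.apath_def)
    then show "recolors G {1..l} (\<lambda>_. enat (card (pverts G))) a b"
      by (intro recolors_weaken[OF awalk_imp_recolors[OF assms]]) simp_all
  qed
  then show ?thesis
    unfolding good_def reducible_def by simp
qed

lemma colorings_nonempty:
  assumes "pair_graph G" "chromatic_number G \<le> l"
  shows "colorings G l \<noteq> {}"
  using colorings_chromatic_number_nonempty[OF assms(1)] assms(2)
    proper_colorings_mono[of "{1..chromatic_number G}" "{1..l}" G]
  by (auto simp: colorings_eq)

text \<open>\<open>connected\<close> asks for a nonempty vertex set and strong connectivity of the
  symmetric closure. The arcs are symmetric already, and the bound on \<open>l\<close> provides a
  vertex.\<close>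

lemma connected_reconf_graph_iff:
  assumes "pair_graph G" "chromatic_number G \<le> l"
  shows "connected (with_proj (reconf_graph G l)) \<longleftrightarrow>
    (\<forall>a \<in> colorings G l. \<forall>b \<in> colorings G l. recolors G {1..l} (\<lambda>_. \<infinity>) a b)"
proof -
  interpret R: pair_graph "reconf_graph G l"
    using assms(1) by (rule pair_graph_reconf_graph)
  have "a \<rightarrow>\<^sup>*\<^bsub>with_proj (reconf_graph G l)\<^esub> b \<longleftrightarrow> recolors G {1..l} (\<lambda>_. \<infinity>) a b" for a b
  proof
    assume "a \<rightarrow>\<^sup>*\<^bsub>with_proj (reconf_graph G l)\<^esub> b"
    then obtain p where "R.awalk a p b"
      by (auto simp: R.reachable_awalk)
    then show "recolors G {1..l} (\<lambda>_. \<infinity>) a b"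
      by (rule awalk_imp_recolors[OF assms(1), THEN recolors_weaken]) simp
  next
    assume "recolors G {1..l} (\<lambda>_. \<infinity>) a b"
    then show "a \<rightarrow>\<^sup>*\<^bsub>with_proj (reconf_graph G l)\<^esub> b"
      using recolors_imp_apath[OF assms(1)] R.reachable_apath by metis
  qed
  moreover have "pverts (reconf_graph G l) = colorings G l"
    by (simp add: reconf_graph_def)
  ultimately show ?thesis
    using colorings_nonempty[OF assms] R.reachable_mk_symmetric_eq[OF R.pair_sym_arcs]
    by (auto simp: connected_def strongly_connected_def)
qed

text \<open>In connected reconfiguration graphs any \<chi>-coloring serves as target. Conversely,
  two colorings that reach the same target reach each other, because sequences can be
  reversed.\<close>

lemma recolorable_iff_reducible:
  assumes "pair_graph G"
  shows "recolorable G \<longleftrightarrow> reducible G \<infinity>"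
proof -
  \<comment> \<open>The target has fewer colors than allowed, but must itself be a vertex of the
    graph for \<open>l\<close> colors.\<close>
  have sub: "colorings G (chromatic_number G) \<subseteq> colorings G l" if "chromatic_number G + 1 \<le> l" for l
    unfolding colorings_eq by (rule proper_colorings_mono) (use that in simp)
  have "recolorable G \<longleftrightarrow> (\<forall>l \<ge> chromatic_number G + 1. \<forall>a \<in> colorings G l. \<forall>b \<in> colorings G l.
      recolors G {1..l} (\<lambda>_. \<infinity>) a b)"
    using connected_reconf_graph_iff[OF assms] by (simp add: recolorable_def)
  also have "\<dots> \<longleftrightarrow> reducible G \<infinity>" (is "?L \<longleftrightarrow> _")
  proof
    assume ?L
    then show "reducible G \<infinity>"
      using sub colorings_chromatic_number_nonempty[OF assms] unfolding reducible_def by blast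
  next
    assume "reducible G \<infinity>"
    then obtain b where b: "recolors G {1..l} (\<lambda>_. \<infinity>) a b"
      if "chromatic_number G + 1 \<le> l" "a \<in> colorings G l" for l a
      unfolding reducible_def by blast
    show ?L
    proof (intro allI ballI impI)
      fix l a a'
      assume "chromatic_number G + 1 \<le> l" "a \<in> colorings G l" "a' \<in> colorings G l"
      then show "recolors G {1..l} (\<lambda>_. \<infinity>) a a'"
        using recolors_trans[OF recolors_sym[OF b] b, of l a' a] by simp
    qed
  qed
  finally show ?thesis .
qed

section \<open>Permuting color classes\<close>

lemma recolors_class:
  assumes "parcs G \<subseteq> pverts G \<times> pverts G" "c \<in> proper_colorings G S"
    and "finite W" "W \<subseteq> pverts G" "\<And>u v. u \<in> W \<Longrightarrow> v \<in> W \<Longrightarrow> c u = c v"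
    and "f \<in> S" "f \<notin> c ` pverts G"
  shows "recolors G S (\<lambda>v. of_bool (v \<in> W)) c (\<lambda>v. if v \<in> W then f else c v)"
  using assms(3-5)
proof (induction W)
  case empty
  then show ?case using assms(2) by (simp add: recolors.refl)
next
  case (insert w W)
  let ?d = "\<lambda>v. if v \<in> insert w W then f else c v"
  have "?d u \<noteq> ?d v" if "(u, v) \<in> parcs G" for u v
  proof -
    have "u \<in> pverts G" "v \<in> pverts G" "c u \<noteq> c v"
      using that assms(1,2) by (auto simp: proper_colorings_def)
    moreover have "c x \<noteq> f" if "x \<in> pverts G" for x
      using assms(7) that by blast
    ultimately show ?thesis
      using insert.prems(2)[of u v] by metis
  qed
  moreover have "?d \<in> pverts G \<rightarrow>\<^sub>E S"
    using assms(2,6) insert.prems(1) by (auto simp: proper_colorings_def PiE_iff extensional_def)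
  ultimately have d: "?d \<in> proper_colorings G S"
    unfolding proper_colorings_def by blast
  have eq: "?d = (\<lambda>v. if v \<in> W then f else c v)(w := f)"
    by auto
  have IH: "recolors G S (\<lambda>v. of_bool (v \<in> W)) c (\<lambda>v. if v \<in> W then f else c v)"
    using insert.IH insert.prems by simp
  show ?case
    using d unfolding eq
    by (intro recolors.step[OF IH]) (use insert in \<open>auto split: if_splits\<close>)
qed

text \<open>
  The number of moves that the color class of \<open>t\<close> needs when the classes are to be moved from \<open>p\<close>
  to \<open>q\<close>: a class whose color is nobody's target goes home directly, any other misplaced one may
  have to be parked on such a color first, in order to break a cycle.
\<close>

definition displacement :: "nat set \<Rightarrow> (nat \<Rightarrow> nat) \<Rightarrow> (nat \<Rightarrow> nat) \<Rightarrow> nat \<Rightarrow> nat" where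
  "displacement T q p t = (if p t = q t then 0 else if p t \<in> q ` T then 2 else 1)"

lemma displacement_le: "displacement T q p t \<le> 2"
  by (simp add: displacement_def)

lemma recolors_permute:
  assumes arcs: "parcs G \<subseteq> pverts G \<times> pverts G" and fin: "finite (pverts G)"
    and b: "b \<in> proper_colorings G T"
    and T: "finite T" "card T < card S" and q: "inj_on q T" "q ` T \<subseteq> S"
    and "inj_on p T" "p ` T \<subseteq> S"
  shows "recolors G S (\<lambda>v. enat (displacement T q p (b v)))
    (compose (pverts G) p b) (compose (pverts G) q b)"
  using assms(8-)
proof (induction "\<Sum>t\<in>T. displacement T q p t" arbitrary: p rule: less_induct)
  case (less p)
  let ?V = "pverts G"
  have bT: "b v \<in> T" if "v \<in> ?V" for v
    using b that by (auto simp: proper_colorings_def)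
  have proper_p: "compose ?V p b \<in> proper_colorings G S"
    by (rule proper_colorings_compose[OF arcs b less.prems])
  \<comment> \<open>The move costs each vertex of class \<open>t\<close> one recoloring, which the
    drop of its displacement pays for.\<close>
  have move: ?case
    if t: "t \<in> T" and f: "f \<in> S" "f \<notin> p ` T"
      and less_t: "displacement T q (p(t := f)) t < displacement T q p t" for t f
  proof -
    let ?p = "p(t := f)"
    let ?W = "{v \<in> ?V. b v = t}"
    \<comment> \<open>The displacement of \<open>s\<close> depends on \<open>p\<close> only through
      \<open>p s\<close>, so the classes other than \<open>t\<close> are unaffected.\<close>
    have le: "displacement T q ?p s \<le> displacement T q p s" for s
      using less_t by (cases "s = t") (auto simp: displacement_def)
    have "(\<Sum>s\<in>T. displacement T q ?p s) < (\<Sum>s\<in>T. displacement T q p s)"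
      using le less_t t by (intro sum_strict_mono_ex1 T) auto
    moreover have "inj_on ?p T"
      using less.prems(1) f(2) by (rule inj_on_fun_updI)
    moreover have "?p ` T \<subseteq> S"
      using less.prems(2) f(1) by auto
    ultimately have later: "recolors G S (\<lambda>v. enat (displacement T q ?p (b v)))
        (compose ?V ?p b) (compose ?V q b)"
      by (rule less.hyps)
    have "recolors G S (\<lambda>v. of_bool (v \<in> ?W)) (compose ?V p b)
        (\<lambda>v. if v \<in> ?W then f else compose ?V p b v)"
      using fin f bT by (intro recolors_class[OF arcs proper_p]) (auto simp: compose_eq)
    moreover have "(\<lambda>v. if v \<in> ?W then f else compose ?V p b v) = compose ?V ?p b"
      by (auto simp: compose_def fun_eq_iff)
    ultimately have "recolors G S (\<lambda>v. of_bool (v \<in> ?W) + enat (displacement T q ?p (b v)))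
        (compose ?V p b) (compose ?V q b)"
      by (intro recolors_trans[OF later]) simp
    then show ?case
    proof (rule recolors_weaken)
      show "of_bool (v \<in> ?W) + enat (displacement T q ?p (b v)) \<le> enat (displacement T q p (b v))" for v
        using less_t le[of "b v"] by (auto simp: one_enat_def)
    qed
  qed
  let ?M = "{t \<in> T. p t \<noteq> q t}"
  \<comment> \<open>Either every class is home, or the home of some misplaced class is vacant, or
    all these homes are occupied and a cycle must be broken.\<close>
  consider "?M = {}" | t where "t \<in> ?M" "q t \<notin> p ` T" | "?M \<noteq> {}" "q ` ?M \<subseteq> p ` T"
    by blast
  then show ?case
  proof cases
    case 1
    then have "compose ?V p b = compose ?V q b"
      using b by (intro compose_cong_PiE[where S = T]) (auto simp: proper_colorings_def)
    then show ?thesis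
      using proper_p by (simp add: recolors.refl)
  next
    case (2 t)
    then show ?thesis
      using q(2) by (intro move[of t "q t"]) (auto simp: displacement_def)
  next
    case 3
    \<comment> \<open>Whatever occupies the home of a misplaced class is itself misplaced: a settled
      class there would have the same home, against injectivity of \<open>q\<close>. Equal
      cardinalities then give equality of the two sets.\<close>
    have "q ` ?M \<subseteq> p ` ?M"
    proof
      fix x assume "x \<in> q ` ?M"
      then obtain t s where t: "t \<in> T" "p t \<noteq> q t" "x = q t" and s: "s \<in> T" "q t = p s"
        using 3(2) by blast
      then have "p s \<noteq> q s"
        using inj_onD[OF q(1), of t s] by auto
      then show "x \<in> p ` ?M"
        using t s by auto
    qed
    moreover have "card (q ` ?M) = card (p ` ?M)"
      using q(1) less.prems(1) by (simp add: card_image inj_on_subset)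
    ultimately have qM: "q ` ?M = p ` ?M"
      using T(1) by (intro card_subset_eq) auto
    have "card (p ` T) < card S"
      using T card_image_le[of T p] by simp
    then have "\<not> S \<subseteq> p ` T"
      using T(1) card_mono[of "p ` T" S] by auto
    then obtain f where f: "f \<in> S" "f \<notin> p ` T"
      by blast
    have "f \<notin> q ` T"
    proof
      assume "f \<in> q ` T"
      then obtain s where s: "s \<in> T" "f = q s"
        by blast
      with f qM have "s \<notin> ?M"
        by blast
      with s have "f = p s"
        by simp
      with s(1) f(2) show False
        by blast
    qed
    moreover obtain t where t: "t \<in> ?M"
      using 3(1) by blast
    moreover have "p t \<in> q ` T"
      using t qM by blast
    ultimately have "displacement T q (p(t := f)) t < displacement T q p t"
      by (auto simp: displacement_def)
    then show ?thesis
      using t f by (intro move[of t f]) auto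
  qed
qed

section \<open>Reaching copies of the target in arbitrary palettes\<close>

lemma compose_compose: "compose A f (compose A g c) = compose A (\<lambda>x. f (g x)) c"
  by (auto simp: compose_def)

text \<open>
  The map \<open>\<pi>\<close> is arbitrary: from colorings with the colors of \<open>S\<close> one reaches the copy of \<open>b\<close> on any
  prescribed colors, as the colors of \<open>S\<close> may be renamed.
\<close>

definition reduces_to :: "'a pair_pre_digraph \<Rightarrow> enat \<Rightarrow> nat set \<Rightarrow> ('a \<Rightarrow> nat) \<Rightarrow> bool" where
  "reduces_to G N T b \<longleftrightarrow> b \<in> proper_colorings G T \<and>
    (\<forall>S \<pi>. \<forall>a \<in> proper_colorings G S. finite S \<and> card T < card S \<and> inj_on \<pi> T \<and> \<pi> ` T \<subseteq> S \<longrightarrow>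
      recolors G S (\<lambda>_. N) a (compose (pverts G) \<pi> b))"

text \<open>The target given by \<open>reducible\<close> is transported to \<open>T\<close> by a
  bijection \<open>\<sigma>\<close>; for each palette \<open>S\<close>, a bijection with
  \<open>{1..card S}\<close> transports the recoloring sequences.\<close>

lemma reducible_imp_reduces_to:
  assumes arcs: "parcs G \<subseteq> pverts G \<times> pverts G" and red: "reducible G N"
    and T: "finite T" "card T = chromatic_number G"
  obtains b where "reduces_to G N T b"
proof -
  let ?n = "chromatic_number G" and ?V = "pverts G"
  obtain b0 where b0: "b0 \<in> proper_colorings G {1..?n}"
    "\<And>l a. ?n + 1 \<le> l \<Longrightarrow> a \<in> proper_colorings G {1..l} \<Longrightarrow> recolors G {1..l} (\<lambda>_. N) a b0"
    using red unfolding reducible_def colorings_eq by blast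
  obtain \<sigma> where \<sigma>: "bij_betw \<sigma> {1..?n} T"
    using T finite_same_card_bij[of "{1..?n}" T] by auto
  have "reduces_to G N T (compose ?V \<sigma> b0)"
    unfolding reduces_to_def
  proof (intro conjI allI ballI impI)
    show "compose ?V \<sigma> b0 \<in> proper_colorings G T"
      using \<sigma> by (intro proper_colorings_compose[OF arcs b0(1)]) (auto simp: bij_betw_def)
  next
    fix S \<pi> a
    assume a: "a \<in> proper_colorings G S"
      and "finite S \<and> card T < card S \<and> inj_on \<pi> T \<and> \<pi> ` T \<subseteq> S"
    then have S: "finite S" "card T < card S" and \<pi>: "inj_on \<pi> T" "\<pi> ` T \<subseteq> S"
      by simp_all
    have "card (S - \<pi> ` T) = card {?n+1..card S}"
      using S \<pi> T by (simp add: card_Diff_subset card_image)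
    then obtain \<rho> where \<rho>: "bij_betw \<rho> {?n+1..card S} (S - \<pi> ` T)"
      using S(1) finite_same_card_bij[of "{?n+1..card S}" "S - \<pi> ` T"] by auto
    \<comment> \<open>The first \<open>?n\<close> colors go to the prescribed copy and the surplus
      ones fill the rest of \<open>S\<close>, so that this bijection carries \<open>b0\<close>
      exactly to the required coloring.\<close>
    let ?\<tau> = "\<lambda>i. if i \<in> {1..?n} then (\<pi> \<circ> \<sigma>) i else \<rho> i"
    have "bij_betw (\<pi> \<circ> \<sigma>) {1..?n} (\<pi> ` T)"
      using \<sigma> \<pi>(1) bij_betw_trans inj_on_imp_bij_betw by blast
    then have "bij_betw ?\<tau> ({1..?n} \<union> {?n+1..card S}) (\<pi> ` T \<union> (S - \<pi> ` T))"
      using \<rho> by (rule bij_betw_disjoint_Un) auto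
    moreover have "{1..?n} \<union> {?n+1..card S} = {1..card S}"
      using S(2) T(2) by auto
    moreover have "\<pi> ` T \<union> (S - \<pi> ` T) = S"
      using \<pi>(2) by auto
    ultimately have "bij_betw ?\<tau> {1..card S} S"
      by (simp only:)
    then obtain \<tau> where \<tau>: "bij_betw \<tau> {1..card S} S" "\<And>i. i \<in> {1..?n} \<Longrightarrow> \<tau> i = \<pi> (\<sigma> i)"
      by (rule that) simp
    \<comment> \<open>\<open>a\<close> is pulled back to the palette \<open>{1..card S}\<close> and
      reduced to \<open>b0\<close> there; the sequence is then pushed forward along
      \<open>\<tau>\<close>.\<close>
    let ?a = "compose ?V (inv_into {1..card S} \<tau>) a"
    have inv: "bij_betw (inv_into {1..card S} \<tau>) S {1..card S}"
      using \<tau>(1) by (rule bij_betw_inv_into)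
    have "?a \<in> proper_colorings G {1..card S}"
      using inv by (intro proper_colorings_compose[OF arcs a]) (auto simp: bij_betw_def)
    then have "recolors G {1..card S} (\<lambda>_. N) ?a b0"
      using S T by (intro b0(2)) auto
    then have "recolors G S (\<lambda>_. N) (compose ?V \<tau> ?a) (compose ?V \<tau> b0)"
      by (rule recolors_compose[OF arcs _ bij_betw_imp_inj_on[OF \<tau>(1)]
          equalityD1[OF bij_betw_imp_surj_on[OF \<tau>(1)]]])
    moreover have "compose ?V \<tau> ?a = a"
      unfolding compose_compose
    proof (rule compose_id_PiE)
      show "a \<in> ?V \<rightarrow>\<^sub>E S"
        using a by (simp add: proper_colorings_def)
      show "\<tau> (inv_into {1..card S} \<tau> s) = s" if "s \<in> S" for s
        using bij_betw_inv_into_right[OF \<tau>(1) that] .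
    qed
    moreover have "compose ?V \<tau> b0 = compose ?V \<pi> (compose ?V \<sigma> b0)"
      unfolding compose_compose
    proof (rule compose_cong_PiE)
      show "b0 \<in> ?V \<rightarrow>\<^sub>E {1..?n}"
        using b0(1) by (simp add: proper_colorings_def)
    qed (rule \<tau>(2))
    ultimately show "recolors G S (\<lambda>_. N) a (compose ?V \<pi> (compose ?V \<sigma> b0))"
      by simp
  qed
  then show ?thesis
    by (rule that)
qed

lemma reduces_to_recolors:
  assumes "reduces_to G N T b" "finite S" "card T < card S" "inj_on \<pi> T" "\<pi> ` T \<subseteq> S"
    and "a \<in> proper_colorings G S"
  shows "recolors G S (\<lambda>_. N) a (compose (pverts G) \<pi> b)"
  using assms by (auto simp: reduces_to_def)

section \<open>Disjoint unions and joins\<close>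

text \<open>Vertices outside \<open>H\<close> keep their colors from \<open>e\<close> and cost
  nothing. What the fixed part demands is isolated in the assumption \<open>proper\<close>, where
  unions and joins differ.\<close>

lemma recolors_override:
  assumes "recolors H T m c d" "pverts H \<subseteq> pverts G"
    and proper: "\<And>c. c \<in> proper_colorings H T \<Longrightarrow> override_on e c (pverts H) \<in> proper_colorings G S"
  shows "recolors G S (\<lambda>v. if v \<in> pverts H then m v else 0)
    (override_on e c (pverts H)) (override_on e d (pverts H))"
  using assms(1)
proof (induction)
  case (refl c m)
  then show ?case by (rule recolors.refl[OF proper])
next
  case (step m c d v x m')
  have eq: "override_on e (d(v := x)) (pverts H) = (override_on e d (pverts H))(v := x)"
    using step.hyps(3) by (auto simp: override_on_def)
  show ?case
    using proper[OF step.hyps(2)] unfolding eq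
    by (intro recolors.step[OF step.IH]) (use step.hyps(3,4) assms(2) in auto)
qed

lemma join_commute: "join G1 G2 = join G2 G1"
  by (auto simp: join_def disjoint_union_def)

lemma disjoint_union_commute: "disjoint_union G1 G2 = disjoint_union G2 G1"
  by (auto simp: disjoint_union_def)

lemma restrict_proper_colorings_iff:
  assumes "parcs G \<subseteq> pverts G \<times> pverts G"
  shows "restrict c (pverts G) \<in> proper_colorings G S \<longleftrightarrow>
    (\<forall>v \<in> pverts G. c v \<in> S) \<and> (\<forall>u v. (u, v) \<in> parcs G \<longrightarrow> c u \<noteq> c v)"
proof -
  have "restrict c (pverts G) u = restrict c (pverts G) v \<longleftrightarrow> c u = c v" if "(u, v) \<in> parcs G" for u v
  proof -
    have "u \<in> pverts G" "v \<in> pverts G"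
      using assms that by auto
    then show ?thesis
      by simp
  qed
  then have "(\<forall>(u, v) \<in> parcs G. restrict c (pverts G) u \<noteq> restrict c (pverts G) v) \<longleftrightarrow>
      (\<forall>u v. (u, v) \<in> parcs G \<longrightarrow> c u \<noteq> c v)"
    by blast
  then show ?thesis
    by (simp add: proper_colorings_def PiE_iff)
qed

section \<open>Colorings of the union and the join in terms of the two sides\<close>

locale disjoint_graphs =
  fixes G1 G2 :: "'a pair_pre_digraph"
  assumes graph1: "pair_graph G1" and graph2: "pair_graph G2"
    and disjoint: "pverts G1 \<inter> pverts G2 = {}"
begin

lemma arcs1: "parcs G1 \<subseteq> pverts G1 \<times> pverts G1" and arcs2: "parcs G2 \<subseteq> pverts G2 \<times> pverts G2"
  and finite1: "finite (pverts G1)" and finite2: "finite (pverts G2)"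
  using graph1 graph2 by (simp_all add: pair_graph_iff)

lemma swap: "disjoint_graphs G2 G1"
  using graph1 graph2 disjoint by (intro disjoint_graphs.intro) auto

lemma proper_colorings_disjoint_union_iff:
  "c \<in> proper_colorings (disjoint_union G1 G2) S \<longleftrightarrow>
    c \<in> extensional (pverts G1 \<union> pverts G2) \<and>
    restrict c (pverts G1) \<in> proper_colorings G1 S \<and> restrict c (pverts G2) \<in> proper_colorings G2 S"
  unfolding restrict_proper_colorings_iff[OF arcs1] restrict_proper_colorings_iff[OF arcs2]
  by (auto simp: proper_colorings_def disjoint_union_def PiE_iff)

text \<open>All cross edges are present, so the two sides interact only by competing for
  colors.\<close>

lemma proper_colorings_join_iff:
  "c \<in> proper_colorings (join G1 G2) S \<longleftrightarrow>
    c \<in> proper_colorings (disjoint_union G1 G2) S \<and> c ` pverts G1 \<inter> c ` pverts G2 = {}"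
  by (auto simp: proper_colorings_def join_def disjoint_union_def)

lemma restrict_override1: "restrict (override_on e c (pverts G1)) (pverts G1) = restrict c (pverts G1)"
  by (auto simp: override_on_def)

lemma restrict_override2: "restrict (override_on e c (pverts G1)) (pverts G2) = restrict e (pverts G2)"
  using disjoint by (auto simp: override_on_def fun_eq_iff)

lemma restrict_proper1: "c \<in> proper_colorings G1 S \<Longrightarrow> restrict c (pverts G1) = c"
  and restrict_proper2: "c \<in> proper_colorings G2 S \<Longrightarrow> restrict c (pverts G2) = c"
  by (auto simp: proper_colorings_def PiE_iff extensional_restrict)

lemma override_disjoint_union:
  assumes "c \<in> proper_colorings G1 S" "restrict e (pverts G2) \<in> proper_colorings G2 S"
    and "e \<in> extensional (pverts G1 \<union> pverts G2)"
  shows "override_on e c (pverts G1) \<in> proper_colorings (disjoint_union G1 G2) S"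
  using assms unfolding proper_colorings_disjoint_union_iff restrict_override1 restrict_override2
  by (auto simp: restrict_proper1 extensional_def override_on_def)

lemma override_join:
  assumes "c \<in> proper_colorings G1 T" "T \<subseteq> S" "T \<inter> e ` pverts G2 = {}"
    and "restrict e (pverts G2) \<in> proper_colorings G2 S"
    and "e \<in> extensional (pverts G1 \<union> pverts G2)"
  shows "override_on e c (pverts G1) \<in> proper_colorings (join G1 G2) S"
proof -
  have "override_on e c (pverts G1) ` pverts G1 \<subseteq> T"
    using assms(1) by (auto simp: proper_colorings_def)
  moreover have "override_on e c (pverts G1) ` pverts G2 = e ` pverts G2"
    using disjoint by (intro image_cong) (auto simp: override_on_def)
  moreover have "override_on e c (pverts G1) \<in> proper_colorings (disjoint_union G1 G2) S"
    using proper_colorings_mono[OF assms(2)] assms(1,4,5) by (intro override_disjoint_union) auto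
  ultimately show ?thesis
    unfolding proper_colorings_join_iff using assms(3) by blast
qed

lemma override_combine:
  assumes "b1 \<in> proper_colorings G1 T1" "b2 \<in> proper_colorings G2 T2"
  shows "override_on b2 b1 (pverts G1) \<in> extensional (pverts G1 \<union> pverts G2)"
    "restrict (override_on b2 b1 (pverts G1)) (pverts G1) = b1"
    "restrict (override_on b2 b1 (pverts G1)) (pverts G2) = b2"
  using assms unfolding restrict_override1 restrict_override2
  by (auto simp: restrict_proper1 restrict_proper2 extensional_def override_on_def proper_colorings_def PiE_iff)

section \<open>Chromatic numbers of the union and the join\<close>

lemma chromatic_number_disjoint_union:
  "chromatic_number (disjoint_union G1 G2) = max (chromatic_number G1) (chromatic_number G2)"
    (is "_ = ?k")
proof (rule antisym)
  obtain b1 b2 where b: "b1 \<in> proper_colorings G1 {1..chromatic_number G1}"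
      "b2 \<in> proper_colorings G2 {1..chromatic_number G2}"
    using graph1 graph2 colorings_chromatic_number_nonempty unfolding colorings_eq by blast
  have "b1 \<in> proper_colorings G1 {1..?k}" "b2 \<in> proper_colorings G2 {1..?k}"
    using b by (auto elim!: proper_colorings_mono[THEN subsetD, rotated])
  then have "override_on b2 b1 (pverts G1) \<in> colorings (disjoint_union G1 G2) ?k"
    unfolding colorings_eq proper_colorings_disjoint_union_iff by (simp add: override_combine)
  then show "chromatic_number (disjoint_union G1 G2) \<le> ?k"
    unfolding chromatic_number_def by (intro Least_le) auto
next
  let ?n = "chromatic_number (disjoint_union G1 G2)"
  obtain c where "c \<in> proper_colorings (disjoint_union G1 G2) {1..?n}"
    using colorings_chromatic_number_nonempty[OF pair_graph_disjoint_union[OF graph1 graph2]]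
    unfolding colorings_eq by blast
  then show "?k \<le> ?n"
    unfolding proper_colorings_disjoint_union_iff
    using chromatic_number_le_card[OF arcs1, of _ "{1..?n}"] chromatic_number_le_card[OF arcs2, of _ "{1..?n}"]
    by auto
qed

text \<open>Collected for later use. The first two palettes are those in which one side can move
  while the other stays fixed; the next two count the colors a side really uses.\<close>

lemma proper_colorings_join_restrict:
  assumes "c \<in> proper_colorings (join G1 G2) S"
  shows "restrict c (pverts G1) \<in> proper_colorings G1 (S - c ` pverts G2)"
    "restrict c (pverts G2) \<in> proper_colorings G2 (S - c ` pverts G1)"
    "restrict c (pverts G1) \<in> proper_colorings G1 (c ` pverts G1)"
    "restrict c (pverts G2) \<in> proper_colorings G2 (c ` pverts G2)"
    "c \<in> extensional (pverts G1 \<union> pverts G2)" "c ` pverts G1 \<subseteq> S" "c ` pverts G2 \<subseteq> S"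
    "c ` pverts G1 \<inter> c ` pverts G2 = {}"
proof -
  show c: "c ` pverts G1 \<inter> c ` pverts G2 = {}" "c \<in> extensional (pverts G1 \<union> pverts G2)"
    using assms by (simp_all add: proper_colorings_join_iff proper_colorings_disjoint_union_iff)
  have r: "restrict c (pverts G1) \<in> proper_colorings G1 S" "restrict c (pverts G2) \<in> proper_colorings G2 S"
    using assms by (simp_all add: proper_colorings_join_iff proper_colorings_disjoint_union_iff)
  show *: "restrict c (pverts G1) \<in> proper_colorings G1 (c ` pverts G1)"
    "restrict c (pverts G2) \<in> proper_colorings G2 (c ` pverts G2)"
    using r[THEN proper_colorings_image] by simp_all
  show S: "c ` pverts G1 \<subseteq> S" "c ` pverts G2 \<subseteq> S"
    using r by (auto simp: proper_colorings_def PiE_iff)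
  show "restrict c (pverts G1) \<in> proper_colorings G1 (S - c ` pverts G2)"
    by (rule proper_colorings_mono[THEN subsetD, OF _ *(1)]) (use c S in blast)
  show "restrict c (pverts G2) \<in> proper_colorings G2 (S - c ` pverts G1)"
    by (rule proper_colorings_mono[THEN subsetD, OF _ *(2)]) (use c S in blast)
qed

lemma override_combine_join:
  assumes "b1 \<in> proper_colorings G1 T1" "b2 \<in> proper_colorings G2 T2" "T1 \<inter> T2 = {}"
  shows "override_on b2 b1 (pverts G1) \<in> proper_colorings (join G1 G2) (T1 \<union> T2)"
proof (rule override_join[OF assms(1)])
  show "T1 \<inter> b2 ` pverts G2 = {}"
    using assms(2,3) by (auto simp: proper_colorings_def)
  show "b2 \<in> extensional (pverts G1 \<union> pverts G2)"
    using assms(2) by (auto simp: proper_colorings_def PiE_iff extensional_def)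
  show "restrict b2 (pverts G2) \<in> proper_colorings G2 (T1 \<union> T2)"
    using assms(2) proper_colorings_mono[of T2 "T1 \<union> T2"] by (auto simp: restrict_proper2)
qed simp

text \<open>Two optimal palettes are placed next to each other. Conversely, the sides use disjoint
  sets of colors, so their cardinalities add up.\<close>

lemma chromatic_number_join:
  "chromatic_number (join G1 G2) = chromatic_number G1 + chromatic_number G2" (is "_ = ?n1 + ?n2")
proof (rule antisym)
  have *: "{1..?n1} \<union> {?n1+1..?n1+?n2} = {1..?n1+?n2}"
    by auto
  obtain b1 b2 where b: "b1 \<in> proper_colorings G1 {1..?n1}" "b2 \<in> proper_colorings G2 {1..?n2}"
    using graph1 graph2 colorings_chromatic_number_nonempty unfolding colorings_eq by blast
  have "compose (pverts G2) ((+) ?n1) b2 \<in> proper_colorings G2 {?n1+1..?n1+?n2}"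
    by (rule proper_colorings_compose[OF arcs2 b(2)]) auto
  from override_combine_join[OF b(1) this]
  have "colorings (join G1 G2) (?n1 + ?n2) \<noteq> {}"
    unfolding * colorings_eq by auto
  then show "chromatic_number (join G1 G2) \<le> ?n1 + ?n2"
    unfolding chromatic_number_def by (intro Least_le)
next
  let ?n = "chromatic_number (join G1 G2)"
  obtain c where "c \<in> proper_colorings (join G1 G2) {1..?n}"
    using colorings_chromatic_number_nonempty[OF pair_graph_join[OF graph1 graph2 disjoint]]
    unfolding colorings_eq by blast
  note c = proper_colorings_join_restrict[OF this]
  have "?n1 + ?n2 \<le> card (c ` pverts G1) + card (c ` pverts G2)"
    using chromatic_number_le_card[OF arcs1 c(3)] chromatic_number_le_card[OF arcs2 c(4)] finite1 finite2
    by (simp add: add_mono)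
  also have "\<dots> = card (c ` pverts G1 \<union> c ` pverts G2)"
    using c(8) finite1 finite2 by (simp add: card_Un_disjoint)
  also have "\<dots> \<le> ?n"
    using card_mono[of "{1..?n}" "c ` pverts G1 \<union> c ` pverts G2"] c(6,7) by simp
  finally show "?n1 + ?n2 \<le> ?n" .
qed

section \<open>Recoloring one side at a time; the disjoint union\<close>

lemma recolors_disjoint_union1:
  assumes "a \<in> proper_colorings (disjoint_union G1 G2) S"
    and "recolors G1 S m (restrict a (pverts G1)) b"
  shows "recolors (disjoint_union G1 G2) S (\<lambda>v. if v \<in> pverts G1 then m v else 0)
    a (override_on a b (pverts G1))"
proof -
  have "override_on a c (pverts G1) \<in> proper_colorings (disjoint_union G1 G2) S"
    if "c \<in> proper_colorings G1 S" for c
    using that assms(1) by (intro override_disjoint_union) (simp_all add: proper_colorings_disjoint_union_iff)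
  from recolors_override[OF assms(2) _ this]
  have "recolors (disjoint_union G1 G2) S (\<lambda>v. if v \<in> pverts G1 then m v else 0)
    (override_on a (restrict a (pverts G1)) (pverts G1)) (override_on a b (pverts G1))"
    by (simp add: disjoint_union_def)
  moreover have "override_on a (restrict a (pverts G1)) (pverts G1) = a"
    by (auto simp: override_on_def)
  ultimately show ?thesis
    by simp
qed

text \<open>While \<open>G2\<close> stays fixed, \<open>G1\<close> can move in any palette
  \<open>T\<close> that avoids the colors on \<open>G2\<close>.\<close>

lemma recolors_join1:
  assumes "a \<in> proper_colorings (join G1 G2) S" "T \<subseteq> S" "T \<inter> a ` pverts G2 = {}"
    and "recolors G1 T m (restrict a (pverts G1)) b"
  shows "recolors (join G1 G2) S (\<lambda>v. if v \<in> pverts G1 then m v else 0) a (override_on a b (pverts G1))"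
proof -
  have "override_on a c (pverts G1) \<in> proper_colorings (join G1 G2) S"
    if "c \<in> proper_colorings G1 T" for c
    using that assms(1-3)
    by (intro override_join) (simp_all add: proper_colorings_join_iff proper_colorings_disjoint_union_iff)
  from recolors_override[OF assms(4) _ this]
  have "recolors (join G1 G2) S (\<lambda>v. if v \<in> pverts G1 then m v else 0)
    (override_on a (restrict a (pverts G1)) (pverts G1)) (override_on a b (pverts G1))"
    by (simp add: join_def disjoint_union_def)
  moreover have "override_on a (restrict a (pverts G1)) (pverts G1) = a"
    by (auto simp: override_on_def)
  ultimately show ?thesis
    by simp
qed

lemma reducible_disjoint_union:
  assumes "reducible G1 N1" "reducible G2 N2" "N1 \<le> N" "N2 \<le> N"
  shows "reducible (disjoint_union G1 G2) N"
proof -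
  let ?G = "disjoint_union G1 G2"
  interpret S: disjoint_graphs G2 G1
    by (rule swap)
  obtain b1 where b1: "b1 \<in> proper_colorings G1 {1..chromatic_number G1}"
      "\<And>l a. chromatic_number G1 + 1 \<le> l \<Longrightarrow> a \<in> proper_colorings G1 {1..l} \<Longrightarrow> recolors G1 {1..l} (\<lambda>_. N1) a b1"
    using assms(1) unfolding reducible_def colorings_eq by blast
  obtain b2 where b2: "b2 \<in> proper_colorings G2 {1..chromatic_number G2}"
      "\<And>l a. chromatic_number G2 + 1 \<le> l \<Longrightarrow> a \<in> proper_colorings G2 {1..l} \<Longrightarrow> recolors G2 {1..l} (\<lambda>_. N2) a b2"
    using assms(2) unfolding reducible_def colorings_eq by blast
  let ?b = "override_on b2 b1 (pverts G1)"
  show ?thesis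
    unfolding reducible_def colorings_eq chromatic_number_disjoint_union
  proof (intro bexI[of _ ?b] allI impI ballI)
    let ?k = "max (chromatic_number G1) (chromatic_number G2)"
    have "b1 \<in> proper_colorings G1 {1..?k}" "b2 \<in> proper_colorings G2 {1..?k}"
      using b1(1) b2(1) by (auto elim!: proper_colorings_mono[THEN subsetD, rotated])
    then show "?b \<in> proper_colorings ?G {1..?k}"
      unfolding proper_colorings_disjoint_union_iff by (simp add: override_combine)
    fix l a
    assume l: "?k + 1 \<le> l" and a: "a \<in> proper_colorings ?G {1..l}"
    let ?a = "override_on a b1 (pverts G1)"
    have "recolors G1 {1..l} (\<lambda>_. N1) (restrict a (pverts G1)) b1"
      using a l by (intro b1(2)) (simp_all add: proper_colorings_disjoint_union_iff)
    from recolors_disjoint_union1[OF a this]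
    have 1: "recolors ?G {1..l} (\<lambda>v. if v \<in> pverts G1 then N1 else 0) a ?a" .
    have a': "?a \<in> proper_colorings ?G {1..l}"
      using recolors_proper(2)[OF 1] .
    then have "restrict ?a (pverts G2) \<in> proper_colorings G2 {1..l}"
      unfolding proper_colorings_disjoint_union_iff by blast
    then have "recolors G2 {1..l} (\<lambda>_. N2) (restrict ?a (pverts G2)) b2"
      using l by (intro b2(2)) auto
    from S.recolors_disjoint_union1[OF _ this, unfolded disjoint_union_commute[of G2 G1], OF a']
    have 2: "recolors ?G {1..l} (\<lambda>v. if v \<in> pverts G2 then N2 else 0) ?a (override_on ?a b2 (pverts G2))" .
    have "override_on ?a b2 (pverts G2) = ?b"
    proof
      fix v
      have "a v = undefined" if "v \<notin> pverts G1 \<union> pverts G2"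
        using a that by (auto simp: proper_colorings_disjoint_union_iff extensional_def)
      moreover have "b2 v = undefined" if "v \<notin> pverts G2"
        using b2(1) that by (auto simp: proper_colorings_def)
      ultimately show "override_on ?a b2 (pverts G2) v = ?b v"
        using disjoint by (auto simp: override_on_def)
    qed
    with recolors_trans[OF 2 1]
    \<comment> \<open>A vertex lies in only one side, so at most one of the two summands is
      nonzero.\<close>
    have "recolors ?G {1..l} (\<lambda>v. (if v \<in> pverts G1 then N1 else 0) + (if v \<in> pverts G2 then N2 else 0)) a ?b"
      by simp
    then show "recolors ?G {1..l} (\<lambda>_. N) a ?b"
    proof (rule recolors_weaken)
      show "(if v \<in> pverts G1 then N1 else 0) + (if v \<in> pverts G2 then N2 else 0) \<le> N" for v
        using assms(3,4) disjoint by auto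
    qed
  qed
qed

section \<open>Reducing the join\<close>

text \<open>The spare color available to \<open>G1\<close> lets it move first. This compresses it to
  at most \<open>card T1\<close> colors and leaves more than \<open>card T2\<close> for
  \<open>G2\<close>. The outcome is the target up to an injective renaming \<open>p\<close>.\<close>

lemma join_two_phases:
  assumes b1: "reduces_to G1 N1 T1 b1" and b2: "reduces_to G2 N2 T2 b2"
    and T: "T1 \<inter> T2 = {}" "finite T1" "finite T2"
    and S: "finite S" "card T1 + card T2 < card S"
    and a: "a \<in> proper_colorings (join G1 G2) S" "card T1 < card (S - a ` pverts G2)"
  obtains p where "inj_on p (T1 \<union> T2)" "p ` (T1 \<union> T2) \<subseteq> S"
    "recolors (join G1 G2) S (\<lambda>v. if v \<in> pverts G1 then N1 else N2) a
      (compose (pverts (join G1 G2)) p (override_on b2 b1 (pverts G1)))"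
proof -
  let ?G = "join G1 G2"
  interpret S: disjoint_graphs G2 G1
    by (rule swap)
  note a1 = proper_colorings_join_restrict[OF a(1)]
  have b1_in: "b1 v \<in> T1" if "v \<in> pverts G1" for v
    using b1 that by (auto simp: reduces_to_def proper_colorings_def)
  have b2_in: "b2 v \<in> T2" if "v \<in> pverts G2" for v
    using b2 that by (auto simp: reduces_to_def proper_colorings_def)
  obtain \<pi>1 where \<pi>1: "\<pi>1 ` T1 \<subseteq> S - a ` pverts G2" "inj_on \<pi>1 T1"
    using card_le_inj[of T1 "S - a ` pverts G2"] T(2) S(1) a(2) by auto
  let ?c = "override_on a (compose (pverts G1) \<pi>1 b1) (pverts G1)"
  have "recolors G1 (S - a ` pverts G2) (\<lambda>_. N1) (restrict a (pverts G1)) (compose (pverts G1) \<pi>1 b1)"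
    using b1 S(1) a(2) \<pi>1 a1(1) by (intro reduces_to_recolors) auto
  from recolors_join1[OF a(1) _ _ this]
  have 1: "recolors ?G S (\<lambda>v. if v \<in> pverts G1 then N1 else 0) a ?c"
    by auto
  have c: "?c \<in> proper_colorings ?G S"
    using recolors_proper(2)[OF 1] .
  have c1: "?c ` pverts G1 \<subseteq> \<pi>1 ` T1"
    using b1_in by (auto simp: compose_eq)
  let ?S = "S - \<pi>1 ` T1"
  have "card (\<pi>1 ` T1) = card T1"
    using \<pi>1(2) by (rule card_image)
  then have card: "card T2 < card ?S"
    using S T \<pi>1(1) by (subst card_Diff_subset) auto
  then obtain \<pi>2 where \<pi>2: "\<pi>2 ` T2 \<subseteq> ?S" "inj_on \<pi>2 T2"
    using card_le_inj[of T2 ?S] T(3) S(1) by auto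
  let ?d = "override_on ?c (compose (pverts G2) \<pi>2 b2) (pverts G2)"
  \<comment> \<open>\<open>\<pi>1\<close> was chosen to avoid the colors on \<open>G2\<close>, so
    these all survive in the smaller palette.\<close>
  have "restrict a (pverts G2) \<in> proper_colorings G2 ?S"
    by (rule proper_colorings_mono[THEN subsetD, OF _ a1(4)]) (use \<pi>1(1) a1(7) in blast)
  then have "restrict ?c (pverts G2) \<in> proper_colorings G2 ?S"
    unfolding restrict_override2 .
  then have "recolors G2 ?S (\<lambda>_. N2) (restrict ?c (pverts G2)) (compose (pverts G2) \<pi>2 b2)"
    using b2 S(1) card \<pi>2 by (intro reduces_to_recolors) auto
  from S.recolors_join1[OF _ _ _ this, unfolded join_commute[of G2 G1], OF c]
  have 2: "recolors ?G S (\<lambda>v. if v \<in> pverts G2 then N2 else 0) ?c ?d"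
    using c1 by blast
  \<comment> \<open>The two renamings glue to an injective one: \<open>T1\<close> and
    \<open>T2\<close> are disjoint, and the values of \<open>\<pi>2\<close> avoid those of
    \<open>\<pi>1\<close>.\<close>
  let ?p = "\<lambda>t. if t \<in> T1 then \<pi>1 t else \<pi>2 t"
  have d: "?d = compose (pverts ?G) ?p (override_on b2 b1 (pverts G1))"
  proof
    fix v
    have "a v = undefined" if "v \<notin> pverts G1 \<union> pverts G2"
      using a1(5) that by (auto simp: extensional_def)
    then show "?d v = compose (pverts ?G) ?p (override_on b2 b1 (pverts G1)) v"
      using disjoint T(1) b1_in[of v] b2_in[of v]
      by (auto simp: override_on_def compose_def join_def disjoint_union_def)
  qed
  show ?thesis
  proof (rule that)
    show "inj_on ?p (T1 \<union> T2)"
    proof (rule inj_onI)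
      fix s t assume st: "s \<in> T1 \<union> T2" "t \<in> T1 \<union> T2" "?p s = ?p t"
      have "\<pi>1 s \<noteq> \<pi>2 t" if "s \<in> T1" "t \<in> T2" for s t
        using that \<pi>2(1) by force
      then show "s = t"
        using st inj_onD[OF \<pi>1(2), of s t] inj_onD[OF \<pi>2(2), of s t] by (metis Un_iff)
    qed
    show "?p ` (T1 \<union> T2) \<subseteq> S"
      using \<pi>1(1) \<pi>2(1) by auto
    show "recolors ?G S (\<lambda>v. if v \<in> pverts G1 then N1 else N2) a
        (compose (pverts ?G) ?p (override_on b2 b1 (pverts G1)))"
      using recolors_trans[OF 2 1] unfolding d
      by (rule recolors_weaken) (use disjoint in auto)
  qed
qed

lemma override_on_swap:
  assumes "b1 \<in> proper_colorings G1 T1" "b2 \<in> proper_colorings G2 T2"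
  shows "override_on b1 b2 (pverts G2) = override_on b2 b1 (pverts G1)"
  using assms disjoint by (auto simp: override_on_def proper_colorings_def PiE_iff extensional_def fun_eq_iff)

text \<open>This is \<open>recolors_permute\<close> with the identity as \<open>q\<close>: each
  color of \<open>T\<close> is its own home.\<close>

lemma recolors_join_canonical:
  assumes "b \<in> proper_colorings (join G1 G2) T" "finite S" "T \<subseteq> S" "card T < card S"
    and "inj_on p T" "p ` T \<subseteq> S"
  shows "recolors (join G1 G2) S (\<lambda>v. enat (displacement T (\<lambda>t. t) p (b v)))
    (compose (pverts (join G1 G2)) p b) b"
proof -
  have "compose (pverts (join G1 G2)) (\<lambda>t. t) b = b"
    using assms(1) by (intro compose_id_PiE[where S = T]) (auto simp: proper_colorings_def)
  then show ?thesis
    using recolors_permute[of "join G1 G2" b T S "\<lambda>t. t" p] assms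
      pair_graph_join[OF graph1 graph2 disjoint] finite_subset[OF assms(3,2)]
    by (auto simp: pair_graph_iff)
qed

text \<open>The \<open>+ 2\<close> pays for undoing the renaming left by
  \<open>join_two_phases\<close>, since displacements are at most 2.\<close>

lemma reducible_join:
  assumes "reducible G1 N1" "reducible G2 N2" "N1 + 2 \<le> N" "N2 + 2 \<le> N"
  shows "reducible (join G1 G2) N"
proof -
  let ?G = "join G1 G2" and ?n1 = "chromatic_number G1" and ?n2 = "chromatic_number G2"
  interpret S: disjoint_graphs G2 G1
    by (rule swap)
  let ?T1 = "{1..?n1}" and ?T2 = "{?n1+1..?n1+?n2}"
  have T: "?T1 \<union> ?T2 = {1..?n1+?n2}" "?T1 \<inter> ?T2 = {}"
    by auto
  have "card ?T1 = ?n1" "card ?T2 = ?n2"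
    by simp_all
  then obtain b1 b2 where b1: "reduces_to G1 N1 ?T1 b1" and b2: "reduces_to G2 N2 ?T2 b2"
    using reducible_imp_reduces_to[OF arcs1 assms(1)] reducible_imp_reduces_to[OF arcs2 assms(2)]
    by (metis finite_atLeastAtMost)
  let ?b = "override_on b2 b1 (pverts G1)"
  have proper: "b1 \<in> proper_colorings G1 ?T1" "b2 \<in> proper_colorings G2 ?T2"
    using b1 b2 by (simp_all add: reduces_to_def)
  have b: "?b \<in> proper_colorings ?G {1..?n1+?n2}"
    using override_combine_join[OF proper T(2)] unfolding T(1) .
  show ?thesis
    unfolding reducible_def colorings_eq chromatic_number_join
  proof (intro bexI[OF _ b] allI impI ballI)
    fix l a
    assume l: "?n1 + ?n2 + 1 \<le> l" and a: "a \<in> proper_colorings ?G {1..l}"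
    note a1 = proper_colorings_join_restrict[OF a]
    have "\<exists>p. inj_on p (?T1 \<union> ?T2) \<and> p ` (?T1 \<union> ?T2) \<subseteq> {1..l} \<and>
      recolors ?G {1..l} (\<lambda>v. if v \<in> pverts G1 then N1 else N2) a (compose (pverts ?G) p ?b)"
    proof (cases "card ?T1 < card ({1..l} - a ` pverts G2)")
      case True
      show ?thesis
        by (rule join_two_phases[OF b1 b2 T(2) _ _ _ _ a True]) (use l in auto)
    next
      case False
      \<comment> \<open>If \<open>G1\<close> has no spare color, \<open>G2\<close> uses at least
        \<open>l - ?n1 > ?n2\<close> colors. None of them occurs on \<open>G1\<close>, so
        \<open>G2\<close> has a spare color and can go first.\<close>
      have "l - ?n1 \<le> card (a ` pverts G2)"
        using False card_Diff_subset[of "a ` pverts G2" "{1..l}"] a1(7) finite2 by simp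
      also have "\<dots> \<le> card ({1..l} - a ` pverts G1)"
        using a1(7,8) by (intro card_mono) auto
      finally have "card ?T2 < card ({1..l} - a ` pverts G1)"
        using l by simp
      moreover have "a \<in> proper_colorings (join G2 G1) {1..l}" "?T2 \<inter> ?T1 = {}"
        using a by (auto simp: join_commute)
      ultimately obtain p where p: "inj_on p (?T2 \<union> ?T1)" "p ` (?T2 \<union> ?T1) \<subseteq> {1..l}"
          "recolors (join G2 G1) {1..l} (\<lambda>v. if v \<in> pverts G2 then N2 else N1) a
            (compose (pverts (join G2 G1)) p (override_on b1 b2 (pverts G2)))"
        using S.join_two_phases[OF b2 b1, of "{1..l}" a] l by auto
      have "recolors ?G {1..l} (\<lambda>v. if v \<in> pverts G1 then N1 else N2) a (compose (pverts ?G) p ?b)"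
        using p(3) unfolding join_commute[of G2 G1] override_on_swap[OF proper]
        by (rule recolors_weaken) (use disjoint in \<open>auto simp: join_def disjoint_union_def\<close>)
      then show ?thesis
        using p(1,2) unfolding Un_commute[of ?T2 ?T1] by blast
    qed
    then obtain p where p: "inj_on p {1..?n1+?n2}" "p ` {1..?n1+?n2} \<subseteq> {1..l}"
      "recolors ?G {1..l} (\<lambda>v. if v \<in> pverts G1 then N1 else N2) a (compose (pverts ?G) p ?b)"
      unfolding T(1) by blast
    have "recolors ?G {1..l} (\<lambda>v. enat (displacement {1..?n1+?n2} (\<lambda>t. t) p (?b v))) (compose (pverts ?G) p ?b) ?b"
      using l by (intro recolors_join_canonical[OF b _ _ _ p(1,2)]) auto
    from recolors_trans[OF this p(3)]
    show "recolors ?G {1..l} (\<lambda>_. N) a ?b"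
    proof (rule recolors_weaken)
      show "(if v \<in> pverts G1 then N1 else N2) + enat (displacement {1..?n1+?n2} (\<lambda>t. t) p (?b v)) \<le> N" for v
      proof -
        have "(if v \<in> pverts G1 then N1 else N2) + enat (displacement {1..?n1+?n2} (\<lambda>t. t) p (?b v))
            \<le> (if v \<in> pverts G1 then N1 else N2) + 2"
          using displacement_le by (intro add_left_mono) (simp add: numeral_eq_enat)
        also have "\<dots> \<le> N"
          using assms(3,4) by simp
        finally show ?thesis .
      qed
    qed
  qed
qed

text \<open>
  With only one additional vertex the budget of \<open>G1\<close> grows by just 1, so \<open>G1\<close> is reduced with
  its colors already in place, except possibly for one class parked on the largest color.
\<close>

lemma reducible_join_singleton:
  assumes "reducible G1 N1" "pverts G2 = {w}" "N1 + 1 \<le> N" "2 \<le> N"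
  shows "reducible (join G1 G2) N"
proof -
  let ?G = "join G1 G2" and ?n = "chromatic_number G1"
  have no_arcs: "parcs G2 = {}"
    using graph2 assms(2) by (auto simp: pair_graph_iff irrefl_def)
  have const: "(\<lambda>x\<in>{w}. k) \<in> proper_colorings G2 {k}" for k
    by (simp add: proper_colorings_def no_arcs assms(2))
  have chi2: "chromatic_number G2 = 1"
  proof (rule antisym)
    show "chromatic_number G2 \<le> 1"
      using chromatic_number_le_card[OF arcs2 const] by simp
    show "1 \<le> chromatic_number G2"
      using colorings_chromatic_number_nonempty[OF graph2] assms(2)
      by (auto simp: colorings_eq proper_colorings_def Suc_le_eq intro!: Nat.gr0I)
  qed
  let ?T = "{1..?n+1}"
  obtain b1 where b1: "reduces_to G1 N1 {1..?n} b1"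
    using reducible_imp_reduces_to[OF arcs1 assms(1), of "{1..?n}"] by auto
  then have b1_proper: "b1 \<in> proper_colorings G1 {1..?n}"
    by (simp add: reduces_to_def)
  then have b1_in: "b1 v \<in> {1..?n}" if "v \<in> pverts G1" for v
    using that by (auto simp: proper_colorings_def)
  let ?b = "override_on (\<lambda>x\<in>{w}. ?n + 1) b1 (pverts G1)"
  have "{1..?n} \<union> {?n+1} = ?T"
    by auto
  then have b: "?b \<in> proper_colorings ?G ?T"
    using override_combine_join[OF b1_proper const, of "?n+1"] by simp
  show ?thesis
    unfolding reducible_def colorings_eq chromatic_number_join chi2
  proof (intro bexI[OF _ b] allI impI ballI)
    fix l a
    assume l: "?n + 1 + 1 \<le> l" and a: "a \<in> proper_colorings ?G {1..l}"
    note a1 = proper_colorings_join_restrict[OF a]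
    let ?s = "a w"
    \<comment> \<open>The copy of \<open>b1\<close> must avoid the color of \<open>w\<close>. Since
      \<open>l\<close> exceeds \<open>?n + 1\<close>, all colors up to \<open>?n\<close> stay in
      place, except that \<open>?s\<close>, if among them, is replaced by \<open>l\<close>.\<close>
    let ?\<pi> = "Transposition.transpose ?s l"
    have s: "a ` pverts G2 = {?s}" "?s \<in> {1..l}"
      using a1(7) by (auto simp: assms(2))
    have \<pi>: "inj_on ?\<pi> {1..?n}" "?\<pi> ` {1..?n} \<subseteq> {1..l} - {?s}"
      using l s(2) by (auto simp: Transposition.transpose_def inj_on_def)
    have "recolors G1 ({1..l} - {?s}) (\<lambda>_. N1) (restrict a (pverts G1)) (compose (pverts G1) ?\<pi> b1)"
      using a1(1) l s by (intro reduces_to_recolors[OF b1 _ _ \<pi>]) (auto simp: card_Diff_singleton)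
    from recolors_join1[OF a _ _ this]
    have 1: "recolors ?G {1..l} (\<lambda>v. if v \<in> pverts G1 then N1 else 0) a
        (override_on a (compose (pverts G1) ?\<pi> b1) (pverts G1))"
      using s(1) by auto
    let ?p = "\<lambda>t. if t \<le> ?n then ?\<pi> t else ?s"
    have p_b: "override_on a (compose (pverts G1) ?\<pi> b1) (pverts G1) = compose (pverts ?G) ?p ?b"
    proof
      fix v
      have "a v = undefined" if "v \<notin> pverts G1 \<union> pverts G2"
        using a1(5) that by (auto simp: extensional_def)
      then show "override_on a (compose (pverts G1) ?\<pi> b1) (pverts G1) v = compose (pverts ?G) ?p ?b v"
        using disjoint b1_in[of v]
        by (auto simp: override_on_def compose_def join_def disjoint_union_def assms(2))
    qed
    have "inj_on ?p ?T" "?p ` ?T \<subseteq> {1..l}"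
      using l s(2) by (auto simp: Transposition.transpose_def inj_on_def)
    then have 2: "recolors ?G {1..l} (\<lambda>v. enat (displacement ?T (\<lambda>t. t) ?p (?b v)))
        (override_on a (compose (pverts G1) ?\<pi> b1) (pverts G1)) ?b"
      unfolding p_b using l by (intro recolors_join_canonical[OF b]) auto
    from recolors_trans[OF 2 1]
    show "recolors ?G {1..l} (\<lambda>_. N) a ?b"
    proof (rule recolors_weaken)
      fix v assume "v \<in> pverts ?G"
      show "(if v \<in> pverts G1 then N1 else 0) + enat (displacement ?T (\<lambda>t. t) ?p (?b v)) \<le> N"
      proof (cases "v \<in> pverts G1")
        case True
        \<comment> \<open>The only class of \<open>G1\<close> that may be misplaced sits on
          \<open>l\<close>, which is nobody's home, so one move brings it back.\<close>
        have "displacement ?T (\<lambda>t. t) ?p t \<le> 1" if "t \<in> {1..?n}" for t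
          using that l by (auto simp: displacement_def Transposition.transpose_def)
        from this[OF b1_in[OF True]]
        have "N1 + enat (displacement ?T (\<lambda>t. t) ?p (?b v)) \<le> N1 + 1"
          using True by (intro add_left_mono) (simp add: one_enat_def)
        also note assms(3)
        finally show ?thesis
          using True by simp
      next
        case False
        \<comment> \<open>\<open>w\<close> was not recolored before, so its two possible moves fit
          the budget.\<close>
        have "enat (displacement ?T (\<lambda>t. t) ?p (?b v)) \<le> 2"
          using displacement_le by (simp add: numeral_eq_enat)
        also note assms(4)
        finally show ?thesis
          using False by simp
      qed
    qed
  qed
qed

section \<open>Goodness: comparing budgets with the number of vertices\<close>

lemma join_empty: "pverts G2 = {} \<Longrightarrow> join G1 G2 = G1"
  using arcs2 by (cases G1) (auto simp: join_def disjoint_union_def)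

lemma good_disjoint_union:
  assumes "good G1" "good G2"
  shows "good (disjoint_union G1 G2)"
proof -
  have "reducible (disjoint_union G1 G2) (enat (card (pverts (disjoint_union G1 G2))))"
    using assms[unfolded good_iff_reducible[OF graph1] good_iff_reducible[OF graph2]]
  proof (rule reducible_disjoint_union)
    show "enat (card (pverts G1)) \<le> enat (card (pverts (disjoint_union G1 G2)))"
      "enat (card (pverts G2)) \<le> enat (card (pverts (disjoint_union G1 G2)))"
      using finite1 finite2 by (simp_all add: disjoint_union_def card_mono)
  qed
  then show ?thesis
    using good_iff_reducible[OF pair_graph_disjoint_union[OF graph1 graph2]] by simp
qed

text \<open>The join has one vertex more than \<open>G1\<close>, which matches
  \<open>N1 + 1\<close>. As \<open>G1\<close> is nonempty there are at least two vertices, enough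
  for the two moves of the single vertex.\<close>

lemma good_join_singleton:
  assumes "good G1" "pverts G1 \<noteq> {}" "card (pverts G2) = 1"
  shows "good (join G1 G2)"
proof -
  obtain w where w: "pverts G2 = {w}"
    using assms(3) card_1_singletonE by blast
  have "card (pverts (join G1 G2)) = card (pverts G1) + 1"
    using finite1 finite2 disjoint assms(3) by (simp add: join_def disjoint_union_def card_Un_disjoint)
  moreover have "1 \<le> card (pverts G1)"
    using assms(2) finite1 by (simp add: Suc_le_eq card_gt_0_iff)
  ultimately have "reducible (join G1 G2) (enat (card (pverts (join G1 G2))))"
    using assms(1)[unfolded good_iff_reducible[OF graph1]] w
    by (intro reducible_join_singleton[of "enat (card (pverts G1))"]) (simp_all add: one_enat_def numeral_eq_enat)
  then show ?thesis
    using good_iff_reducible[OF pair_graph_join[OF graph1 graph2 disjoint]] by simp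
qed

lemma good_join:
  assumes "good G1" "good G2"
  shows "good (join G1 G2)"
proof -
  interpret S: disjoint_graphs G2 G1
    by (rule swap)
  \<comment> \<open>The \<open>+ 2\<close> of \<open>reducible_join\<close> is covered when each
    side contributes at least two vertices to the budget of the other; smaller sides are treated
    separately.\<close>
  consider "pverts G1 = {}" | "pverts G2 = {}"
    | "pverts G1 \<noteq> {}" "card (pverts G2) = 1" | "pverts G2 \<noteq> {}" "card (pverts G1) = 1"
    | "2 \<le> card (pverts G1)" "2 \<le> card (pverts G2)"
    using finite1 finite2 by (metis One_nat_def Suc_1 card_0_eq less_2_cases not_le)
  then show ?thesis
  proof cases
    case 1
    then show ?thesis
      using S.join_empty assms(2) join_commute by metis
  next
    case 2
    then show ?thesis
      using join_empty assms(1) by simp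
  next
    case 3
    then show ?thesis
      by (rule good_join_singleton[OF assms(1)])
  next
    case 4
    then show ?thesis
      using S.good_join_singleton[OF assms(2)] by (simp add: join_commute)
  next
    case 5
    have "card (pverts (join G1 G2)) = card (pverts G1) + card (pverts G2)"
      using finite1 finite2 disjoint by (simp add: join_def disjoint_union_def card_Un_disjoint)
    then have "reducible (join G1 G2) (enat (card (pverts (join G1 G2))))"
      using assms[unfolded good_iff_reducible[OF graph1] good_iff_reducible[OF graph2]] 5
      by (intro reducible_join[of "enat (card (pverts G1))" "enat (card (pverts G2))"])
        (simp_all add: numeral_eq_enat)
    then show ?thesis
      using good_iff_reducible[OF pair_graph_join[OF graph1 graph2 disjoint]] by simp
  qed
qed

end

theorem lemma4:
  fixes G G1 G2 :: "'a pair_pre_digraph"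
  assumes "pair_graph G1" and "pair_graph G2"
    and "pverts G1 \<inter> pverts G2 = {}"
    and "G = disjoint_union G1 G2 \<or> G = join G1 G2"
  shows "(recolorable G \<or> (\<exists>H \<in> {G1, G2}. \<not> recolorable H))
    \<and> (good G1 \<and> good G2 \<longrightarrow> good G)"
proof -
  interpret disjoint_graphs G1 G2
    using assms(1-3) by (rule disjoint_graphs.intro)
  have G: "pair_graph G"
    using assms(4)
  proof
    show "pair_graph G" if "G = disjoint_union G1 G2"
      unfolding that by (rule pair_graph_disjoint_union[OF graph1 graph2])
    show "pair_graph G" if "G = join G1 G2"
      unfolding that by (rule pair_graph_join[OF graph1 graph2 disjoint])
  qed
  have "recolorable G" if "recolorable G1" "recolorable G2"
  proof -
    have red: "reducible G1 \<infinity>" "reducible G2 \<infinity>"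
      using that by (simp_all only: recolorable_iff_reducible graph1 graph2)
    \<comment> \<open>The infinite budget absorbs the \<open>+ 2\<close>, so small sides need no
      separate treatment here.\<close>
    have "reducible (disjoint_union G1 G2) \<infinity>" "reducible (join G1 G2) \<infinity>"
      by (rule reducible_disjoint_union[OF red] reducible_join[OF red]; simp)+
    then show ?thesis
      using assms(4) by (metis recolorable_iff_reducible[OF G])
  qed
  moreover have "good G" if "good G1" "good G2"
    using that assms(4) good_disjoint_union good_join by blast
  ultimately show ?thesis
    by blast
qed

end
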